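(* Let $G$ be a finite group and let $g \in G$. Then $$\mathrm{Pr}_g(G,\mathrm{Aut}(G)) = \frac{1}{|G||\mathrm{Aut}(G)|}\sum_{\substack{x\in G\\ xg\in \mathrm{orb}(x)}}|C_{\mathrm{Aut}(G)}(x)| = \frac{1}{|G|}\sum_{\substack{x\in G\\ xg\in \mathrm{orb}(x)}}\frac{1}{|\mathrm{orb}(x)|}.$$
   Context: For a finite group $G$ with automorphism group $\mathrm{Aut}(G)$, $x\in G$ and $\alpha\in\mathrm{Aut}(G)$, write $[x,\alpha] := x^{-1}\alpha(x)$. For $g \in G$, $$\mathrm{Pr}_g(G,\mathrm{Aut}(G)) := \frac{|\{(x,\alpha)\in G\times \mathrm{Aut}(G) : [x,\alpha]=g\}|}{|G||\mathrm{Aut}(G)|}.$$ For $x\in G$, $C_{\mathrm{Aut}(G)}(x) := \{\alpha\in \mathrm{Aut}(G) : \alpha(x)=x\}$ and $\mathrm{orb}(x) := \{\alpha(x) : \alpha\in\mathrm{Aut}(G)\}$. *)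

theory Defs
  imports Complex_Main "HOL-Algebra.Algebra"
begin

text \<open>
  Automorphisms are the elements of the library group \<^const>\<open>AutoGroup\<close>: bijective endomorphisms
  that are extensional (undefined outside the carrier), so that each automorphism of \<open>G\<close> is
  counted exactly once.
\<close>

abbreviation Aut :: "('a, 'b) monoid_scheme \<Rightarrow> ('a \<Rightarrow> 'a) set"
  where "Aut G \<equiv> carrier (AutoGroup G)"

definition autocommutator :: "('a, 'b) monoid_scheme \<Rightarrow> 'a \<Rightarrow> ('a \<Rightarrow> 'a) \<Rightarrow> 'a"
  where "autocommutator G x \<alpha> = inv\<^bsub>G\<^esub> x \<otimes>\<^bsub>G\<^esub> \<alpha> x"

definition autocommuting_prob :: "('a, 'b) monoid_scheme \<Rightarrow> 'a \<Rightarrow> real"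
  where "autocommuting_prob G g =
    real (card {(x, \<alpha>) \<in> carrier G \<times> Aut G. autocommutator G x \<alpha> = g}) /
    (real (card (carrier G)) * real (card (Aut G)))"

text \<open>The centralizer and the orbit of \<open>x\<close> under the tautological action of
  \<^term>\<open>AutoGroup G\<close> on \<^term>\<open>carrier G\<close>.\<close>

definition aut_centralizer :: "('a, 'b) monoid_scheme \<Rightarrow> 'a \<Rightarrow> ('a \<Rightarrow> 'a) set"
  where "aut_centralizer G x = stabilizer (AutoGroup G) (\<lambda>\<alpha>. \<alpha>) x"

definition aut_orbit :: "('a, 'b) monoid_scheme \<Rightarrow> 'a \<Rightarrow> 'a set"
  where "aut_orbit G x = orbit (AutoGroup G) (\<lambda>\<alpha>. \<alpha>) x"

end

theory Submission
  imports Defs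
begin

text \<open>
  Count the pairs \<open>(x, \<alpha>)\<close> with \<open>[x, \<alpha>] = g\<close> one \<open>x\<close> at a time. The equation
  \<open>x\<^sup>-\<^sup>1 \<alpha>(x) = g\<close> says exactly that \<open>\<alpha>\<close> moves \<open>x\<close> to \<open>xg\<close>. Such \<open>\<alpha>\<close> exist only if \<open>xg\<close>
  lies in the orbit of \<open>x\<close>, and then they form a coset of the centralizer of \<open>x\<close>, so that each
  such \<open>x\<close> contributes as many pairs as its centralizer has elements
  (\<open>card_transporter\<close>). This is the first formula; the second follows
  from it term by term, by the orbit-stabilizer theorem for the action of the automorphism group.
\<close>

lemma (in group_action) transporter_empty_iff:
  "{h \<in> carrier G. \<phi> h x = y} = {} \<longleftrightarrow> y \<notin> orbit G \<phi> x"
  unfolding orbit_def by blast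

text \<open>
  If \<open>a\<close> moves \<open>x\<close> to \<open>y\<close>, left multiplication by \<open>a\<close> maps the stabilizer of \<open>x\<close> bijectively
  onto the set of all elements moving \<open>x\<close> to \<open>y\<close>.
\<close>

lemma (in group_action) card_transporter:
  assumes x: "x \<in> E" and y: "y \<in> orbit G \<phi> x"
  shows "card {h \<in> carrier G. \<phi> h x = y} = card (stabilizer G \<phi> x)"
proof -
  interpret group G
    using group_hom group_hom.axioms(1) by auto
  obtain a where a: "a \<in> carrier G" "\<phi> a x = y"
    using y unfolding orbit_def by blast
  have a_inv: "\<phi> (inv a) y = x"
    using orbit_sym_aux a x by blast
  have "bij_betw (\<lambda>s. a \<otimes> s) (stabilizer G \<phi> x) {h \<in> carrier G. \<phi> h x = y}"
  proof (rule bij_betw_byWitness[where f' = "\<lambda>h. inv a \<otimes> h"])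
    show "\<forall>s\<in>stabilizer G \<phi> x. inv a \<otimes> (a \<otimes> s) = s"
      using a by (simp add: stabilizer_def m_assoc[symmetric])
    show "\<forall>h\<in>{h \<in> carrier G. \<phi> h x = y}. a \<otimes> (inv a \<otimes> h) = h"
      using a by (simp add: m_assoc[symmetric])
    show "(\<lambda>s. a \<otimes> s) ` stabilizer G \<phi> x \<subseteq> {h \<in> carrier G. \<phi> h x = y}"
      using a x by (auto simp: stabilizer_def composition_rule)
    show "(\<lambda>h. inv a \<otimes> h) ` {h \<in> carrier G. \<phi> h x = y} \<subseteq> stabilizer G \<phi> x"
      using a x a_inv by (auto simp: stabilizer_def composition_rule)
  qed
  then show ?thesis
    by (simp add: bij_betw_same_card)
qed

lemma (in group) AutoGroup_action:
  "group_action (AutoGroup G) (carrier G) (\<lambda>\<alpha>. \<alpha>)"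
proof -
  have "(\<lambda>\<alpha>. \<alpha>) \<in> hom (AutoGroup G) (BijGroup (carrier G))"
    by (auto simp: hom_def AutoGroup_def BijGroup_def auto_def)
  then show ?thesis
    by (simp add: group_action_def group_hom_def group_hom_axioms_def AutoGroup group_BijGroup)
qed

lemma finite_Aut:
  assumes "finite (carrier G)"
  shows "finite (Aut G)"
proof (rule finite_subset)
  show "Aut G \<subseteq> carrier G \<rightarrow>\<^sub>E carrier G"
    by (auto simp: AutoGroup_def auto_def PiE_def Bij_imp_extensional Bij_imp_funcset
        dest: hom_in_carrier)
  show "finite (carrier G \<rightarrow>\<^sub>E carrier G)"
    using assms by (simp add: finite_PiE)
qed

lemma (in group) autocommutator_eq_iff:
  assumes "x \<in> carrier G" "g \<in> carrier G" "\<alpha> \<in> Aut G"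
  shows "autocommutator G x \<alpha> = g \<longleftrightarrow> \<alpha> x = x \<otimes> g"
proof -
  have "\<alpha> x \<in> carrier G"
    using group_action.element_image[OF AutoGroup_action] assms by blast
  then show ?thesis
    unfolding autocommutator_def
    using assms by (auto simp: m_assoc[symmetric])
qed

theorem theorem2p3:
  fixes G :: "('a, 'b) monoid_scheme" and g :: 'a
  assumes "group G" and "finite (carrier G)" and "g \<in> carrier G"
  shows "autocommuting_prob G g =
           1 / (real (card (carrier G)) * real (card (Aut G))) *
           (\<Sum>x | x \<in> carrier G \<and> x \<otimes>\<^bsub>G\<^esub> g \<in> aut_orbit G x. real (card (aut_centralizer G x)))
       \<and> 1 / (real (card (carrier G)) * real (card (Aut G))) *
           (\<Sum>x | x \<in> carrier G \<and> x \<otimes>\<^bsub>G\<^esub> g \<in> aut_orbit G x. real (card (aut_centralizer G x))) =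
         1 / real (card (carrier G)) *
           (\<Sum>x | x \<in> carrier G \<and> x \<otimes>\<^bsub>G\<^esub> g \<in> aut_orbit G x. 1 / real (card (aut_orbit G x)))"
proof -
  interpret group G by fact
  interpret A: group_action "AutoGroup G" "carrier G" "\<lambda>\<alpha>. \<alpha>"
    by (rule AutoGroup_action)
  let ?S = "{x. x \<in> carrier G \<and> x \<otimes>\<^bsub>G\<^esub> g \<in> aut_orbit G x}"
  let ?T = "\<lambda>x. {\<alpha> \<in> Aut G. \<alpha> x = x \<otimes>\<^bsub>G\<^esub> g}"
  have finA: "finite (Aut G)"
    using assms(2) by (rule finite_Aut)
  have Aut_pos: "card (Aut G) > 0"
    using finA group.is_monoid[OF AutoGroup] monoid.one_closed card_gt_0_iff by blast
  have "{(x, \<alpha>) \<in> carrier G \<times> Aut G. autocommutator G x \<alpha> = g} = Sigma (carrier G) ?T"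
    using autocommutator_eq_iff[OF _ assms(3)] by blast
  then have "card {(x, \<alpha>) \<in> carrier G \<times> Aut G. autocommutator G x \<alpha> = g}
      = (\<Sum>x\<in>carrier G. card (?T x))"
    using assms(2) finA by simp
  also have "\<dots> = (\<Sum>x\<in>?S. card (?T x))"
  proof (rule sum.mono_neutral_right)
    have "?T x = {}" if "x \<in> carrier G - ?S" for x
      using that A.transporter_empty_iff[of x "x \<otimes>\<^bsub>G\<^esub> g"] unfolding aut_orbit_def by blast
    then show "\<forall>x\<in>carrier G - ?S. card (?T x) = 0"
      by (metis (no_types, lifting) card.empty)
  qed (use assms(2) in auto)
  also have "\<dots> = (\<Sum>x\<in>?S. card (aut_centralizer G x))"
    by (rule sum.cong) (auto simp: A.card_transporter aut_orbit_def aut_centralizer_def)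
  finally have count: "card {(x, \<alpha>) \<in> carrier G \<times> Aut G. autocommutator G x \<alpha> = g}
      = (\<Sum>x\<in>?S. card (aut_centralizer G x))" .
  have centralizer: "real (card (aut_centralizer G x)) =
      real (card (Aut G)) * (1 / real (card (aut_orbit G x)))" if "x \<in> ?S" for x
  proof -
    have os: "card (aut_orbit G x) * card (aut_centralizer G x) = card (Aut G)"
      using that A.orbit_stabilizer_theorem[of x]
      by (simp add: aut_orbit_def aut_centralizer_def order_def)
    then have "card (aut_orbit G x) \<noteq> 0"
      using Aut_pos by (metis mult_zero_left less_irrefl)
    then show ?thesis
      by (simp add: os[symmetric])
  qed
  have "(\<Sum>x\<in>?S. real (card (aut_centralizer G x)))
      = real (card (Aut G)) * (\<Sum>x\<in>?S. 1 / real (card (aut_orbit G x)))"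
    using centralizer by (simp only: sum_distrib_left cong: sum.cong)
  then show ?thesis
    unfolding autocommuting_prob_def count using Aut_pos by simp
qed

end
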